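(* Let $\Phi$ be a crystallographic root system with positive system $\Phi^+$, and let $I$ be an ideal in the root poset of $\Phi$. Then $\theta^{-1}(\mathbf{Pan}(I))$ is the unique dominant region of the Catalan arrangement of $\Phi$ whose set of ceilings is exactly the set of floors of the region $\theta^{-1}(I)$.
   Context: $\Phi$ lives in a Euclidean space $V$ with inner product $\langle\cdot,\cdot\rangle$, simple system $S$. $H_\alpha^r=\{x\in V\mid\langle x,\alpha\rangle=r\}$. The Catalan arrangement consists of the hyperplanes $H_\alpha^0,H_\alpha^1$ for $\alpha\in\Phi$; its regions are the connected components of its complement; $R$ is dominant if $\langle x,\alpha\rangle>0$ for all $\alpha\in\Phi^+$, $x\in R$. Walls of $R$ are hyperplanes of the arrangement supporting a facet of $R$; a ceiling is a wall not containing the origin with the origin on the same side as $R$; a floor is a wall not containing the origin that separates $R$ from the origin. The root poset is $\Phi^+$ with $\alpha\le\beta$ iff $\beta-\alpha$ is a nonnegative integer combination of $S$; ideals are down-closed subsets. For a dominant region $R$ of the Catalan arrangement, $\theta(R)=\{\alpha\in\Phi^+\mid\langle x,\alpha\rangle<1\text{ for all }x\in R\}$; $\theta$ is known to be a bijection from dominant regions of the Catalan arrangement to ideals of the root poset. The Panyushev complement $\mathbf{Pan}(I)$ of an ideal $I$ is the ideal generated by the minimal elements of the order filter $\Phi^+\setminus I$. *)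

theory Defs
  imports "HOL-Analysis.Analysis"
begin

definition crystallographic_root_system :: "'a::euclidean_space set \<Rightarrow> bool" where
  "crystallographic_root_system \<Phi> \<longleftrightarrow>
     finite \<Phi> \<and> 0 \<notin> \<Phi> \<and> span \<Phi> = UNIV \<and>
     (\<forall>\<alpha>\<in>\<Phi>. \<forall>c::real. c *\<^sub>R \<alpha> \<in> \<Phi> \<longleftrightarrow> c = 1 \<or> c = -1) \<and>
     (\<forall>\<alpha>\<in>\<Phi>. \<forall>\<beta>\<in>\<Phi>. \<beta> - (2 * (\<beta> \<bullet> \<alpha>) / (\<alpha> \<bullet> \<alpha>)) *\<^sub>R \<alpha> \<in> \<Phi>) \<and>
     (\<forall>\<alpha>\<in>\<Phi>. \<forall>\<beta>\<in>\<Phi>. 2 * (\<beta> \<bullet> \<alpha>) / (\<alpha> \<bullet> \<alpha>) \<in> \<int>)"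

definition positive_system :: "'a::euclidean_space set \<Rightarrow> 'a set \<Rightarrow> bool" where
  "positive_system \<Phi> P \<longleftrightarrow>
     (\<exists>v. (\<forall>\<alpha>\<in>\<Phi>. v \<bullet> \<alpha> \<noteq> 0) \<and> P = {\<alpha>\<in>\<Phi>. v \<bullet> \<alpha> > 0})"

definition simple_system :: "'a::euclidean_space set \<Rightarrow> 'a set \<Rightarrow> bool" where
  "simple_system P S \<longleftrightarrow> S \<subseteq> P \<and> independent S \<and>
     (\<forall>\<alpha>\<in>P. \<exists>c. (\<forall>s\<in>S. c s \<ge> (0::real)) \<and> \<alpha> = (\<Sum>s\<in>S. c s *\<^sub>R s))"

definition root_le :: "'a::euclidean_space set \<Rightarrow> 'a \<Rightarrow> 'a \<Rightarrow> bool" where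
  "root_le S \<alpha> \<beta> \<longleftrightarrow> (\<exists>c::'a \<Rightarrow> nat. \<beta> - \<alpha> = (\<Sum>s\<in>S. of_nat (c s) *\<^sub>R s))"

definition root_ideal :: "'a::euclidean_space set \<Rightarrow> 'a set \<Rightarrow> 'a set \<Rightarrow> bool" where
  "root_ideal P S I \<longleftrightarrow> I \<subseteq> P \<and> (\<forall>\<beta>\<in>I. \<forall>\<alpha>\<in>P. root_le S \<alpha> \<beta> \<longrightarrow> \<alpha> \<in> I)"

definition Pan :: "'a::euclidean_space set \<Rightarrow> 'a set \<Rightarrow> 'a set \<Rightarrow> 'a set" where
  "Pan P S I =
     (let M = {\<gamma>\<in>P - I. \<forall>\<delta>\<in>P - I. root_le S \<delta> \<gamma> \<longrightarrow> \<delta> = \<gamma>}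
      in {\<alpha>\<in>P. \<exists>\<gamma>\<in>M. root_le S \<alpha> \<gamma>})"

definition hyp :: "'a::euclidean_space \<Rightarrow> real \<Rightarrow> 'a set" where
  "hyp \<alpha> r = {x. x \<bullet> \<alpha> = r}"

definition catalan_hyperplanes :: "'a::euclidean_space set \<Rightarrow> 'a set set" where
  "catalan_hyperplanes \<Phi> = {hyp \<alpha> r | \<alpha> r. \<alpha> \<in> \<Phi> \<and> (r = 0 \<or> r = 1)}"

definition catalan_regions :: "'a::euclidean_space set \<Rightarrow> 'a set set" where
  "catalan_regions \<Phi> = components (- \<Union>(catalan_hyperplanes \<Phi>))"

definition dominant :: "'a::euclidean_space set \<Rightarrow> 'a set \<Rightarrow> bool" where
  "dominant P R \<longleftrightarrow> (\<forall>x\<in>R. \<forall>\<alpha>\<in>P. x \<bullet> \<alpha> > 0)"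

definition dominant_regions :: "'a::euclidean_space set \<Rightarrow> 'a set \<Rightarrow> 'a set set" where
  "dominant_regions \<Phi> P = {R \<in> catalan_regions \<Phi>. dominant P R}"

definition walls :: "'a::euclidean_space set \<Rightarrow> 'a set \<Rightarrow> 'a set set" where
  "walls \<Phi> R = {H \<in> catalan_hyperplanes \<Phi>. (closure R \<inter> H) facet_of (closure R)}"

definition same_side :: "'a::euclidean_space set \<Rightarrow> 'a \<Rightarrow> 'a set \<Rightarrow> bool" where
  "same_side H x R \<longleftrightarrow> (\<exists>a r. a \<noteq> 0 \<and> H = {y. a \<bullet> y = r} \<and> a \<bullet> x < r \<and> (\<forall>y\<in>R. a \<bullet> y < r))"

definition separates :: "'a::euclidean_space set \<Rightarrow> 'a \<Rightarrow> 'a set \<Rightarrow> bool" where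
  "separates H x R \<longleftrightarrow> (\<exists>a r. a \<noteq> 0 \<and> H = {y. a \<bullet> y = r} \<and> a \<bullet> x < r \<and> (\<forall>y\<in>R. a \<bullet> y > r))"

definition ceilings :: "'a::euclidean_space set \<Rightarrow> 'a set \<Rightarrow> 'a set set" where
  "ceilings \<Phi> R = {H \<in> walls \<Phi> R. 0 \<notin> H \<and> same_side H 0 R}"

definition floors :: "'a::euclidean_space set \<Rightarrow> 'a set \<Rightarrow> 'a set set" where
  "floors \<Phi> R = {H \<in> walls \<Phi> R. 0 \<notin> H \<and> separates H 0 R}"

definition theta :: "'a::euclidean_space set \<Rightarrow> 'a set \<Rightarrow> 'a set" where
  "theta P R = {\<alpha>\<in>P. \<forall>x\<in>R. x \<bullet> \<alpha> < 1}"

definition theta_inv :: "'a::euclidean_space set \<Rightarrow> 'a set \<Rightarrow> 'a set \<Rightarrow> 'a set" where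
  "theta_inv \<Phi> P I = the_inv_into (dominant_regions \<Phi> P) (theta P) I"

end

theory Submission
  imports Defs "HOL-Library.Multiset"
begin

text \<open>The main point is that every ideal \<open>J\<close> of the root poset has a nonempty cell, i.e. the
  dominant points with \<open>\<langle>x, \<alpha>\<rangle> < 1\<close> exactly for \<open>\<alpha> \<in> J\<close> and all other values \<open>> 1\<close>. Otherwise Gordan's
  alternative and simultaneous Diophantine approximation yield positive roots with
  \<open>\<Sum> \<beta>\<^sub>i + \<Sum> \<epsilon>\<^sub>k = \<Sum> \<gamma>\<^sub>j\<close>, where the \<open>\<beta>\<^sub>i\<close> lie outside \<open>J\<close>, the \<open>\<gamma>\<^sub>j\<close> lie in \<open>J\<close> and there are at least as
  many \<open>\<beta>\<^sub>i\<close> as \<open>\<gamma>\<^sub>j\<close>. Since two distinct roots with positive inner product differ by a root, such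
  a relation can be shortened until it becomes absurd.

  Consequently the ceilings of the cell of \<open>J\<close> are the hyperplanes \<open>H\<^sub>\<alpha>\<^sup>1\<close> with \<open>\<alpha>\<close> maximal in \<open>J\<close>: for
  such \<open>\<alpha>\<close> the cells of \<open>J\<close> and \<open>J - {\<alpha>}\<close> are adjacent, while for any other \<open>\<alpha> < \<beta>\<close> in \<open>J\<close> a facet in
  \<open>H\<^sub>\<alpha>\<^sup>1\<close> would also lie in \<open>H\<^sub>\<beta>\<^sup>1\<close>. Dually, its floors come from the minimal elements of the complement
  of \<open>J\<close>. The maximal elements of \<open>Pan(I)\<close> are the minimal elements of the complement of \<open>I\<close>, and an
  ideal is determined by its maximal elements.\<close>

section \<open>Integral relations between vectors\<close>

lemma inner_sum_mset_left: "\<Sum>\<^sub># M \<bullet> y = (\<Sum>x\<in>#M. x \<bullet> y)"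
  by (induction M) (simp_all add: inner_add_left)

lemma sum_mset_pos_obtain:
  fixes f :: "'a \<Rightarrow> real"
  assumes "(\<Sum>x\<in>#M. f x) > 0"
  obtains x where "x \<in># M" "f x > 0"
proof -
  have "(\<Sum>x\<in>#M. f x) \<le> 0" if "\<forall>x\<in>#M. f x \<le> 0"
    using that by (induction M) auto
  then show thesis using assms that by (meson not_le)
qed

lemma sum_mset_pos:
  fixes f :: "'a \<Rightarrow> real"
  assumes "\<And>x. x \<in># M \<Longrightarrow> f x > 0" "M \<noteq> {#}"
  shows "(\<Sum>x\<in>#M. f x) > 0"
  using assms
proof (induction M)
  case (add x M)
  then show ?case by (cases "M = {#}") (auto simp: add_pos_pos)
qed simp

lemma sum_mset_sum_replicate:
  fixes w :: "'a::real_vector \<Rightarrow> nat"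
  assumes "finite A"
  shows "\<Sum>\<^sub># (\<Sum>a\<in>A. replicate_mset (w a) a) = (\<Sum>a\<in>A. real (w a) *\<^sub>R a)"
proof -
  have rep: "\<Sum>\<^sub># (replicate_mset n a) = real n *\<^sub>R a" for n and a :: 'a
    by (induction n) (auto simp: scaleR_add_left)
  show ?thesis using assms
    by (induction A rule: finite_induct) (auto simp: rep)
qed

lemma Dirichlet_approx_ex:
  fixes \<theta> :: "nat \<Rightarrow> real" and N n :: nat
  assumes "N > 0"
  shows "\<exists>q p. 0 < q \<and> (\<forall>i<n. \<bar>of_int q * \<theta> i - of_int (p i)\<bar> < 1 / real N)"
proof -
  obtain q p where "0 < q" "q \<le> int (N ^ n)"
    and "\<And>i. i < n \<Longrightarrow> \<bar>of_int q * \<theta> i - of_int (p i)\<bar> < 1 / real N"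
    using Dirichlet_approx_simult[OF assms] by blast
  then show ?thesis by blast
qed

text \<open>The real relation provided by Gordan's alternative is rounded to an integral one by
  simultaneous Diophantine approximation; the rounding error lies in a lattice on which the
  functionals in \<open>\<Psi>\<close> are integral, and is too small to be nonzero.\<close>

lemma integral_gordan:
  fixes A \<Psi> :: "'b::euclidean_space set"
  assumes fin: "finite A" "finite \<Psi>"
    and int: "\<And>a \<psi>. a \<in> A \<Longrightarrow> \<psi> \<in> \<Psi> \<Longrightarrow> \<psi> \<bullet> a \<in> \<int>"
    and sep: "\<And>w. (\<And>\<psi>. \<psi> \<in> \<Psi> \<Longrightarrow> \<psi> \<bullet> w = 0) \<Longrightarrow> w = 0"
    and infeasible: "\<nexists>x. \<forall>a\<in>A. x \<bullet> a > 0"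
  obtains N where "N \<noteq> {#}" "set_mset N \<subseteq> A" "\<Sum>\<^sub># N = 0"
proof -
  have "0 \<in> convex hull A"
  proof (rule ccontr)
    assume "0 \<notin> convex hull A"
    then obtain x b where "0 < b" "\<forall>a\<in>convex hull A. x \<bullet> a > b"
      using separating_hyperplane_closed_0[of "convex hull A"] finite_imp_compact_convex_hull[OF fin(1)]
        compact_imp_closed by blast
    then have "\<forall>a\<in>A. x \<bullet> a > 0"
      using hull_inc[of _ A convex] by (meson less_trans)
    then show False using infeasible by blast
  qed
  then obtain u where u: "\<And>a. a \<in> A \<Longrightarrow> 0 \<le> u a" "sum u A = (1::real)" "(\<Sum>a\<in>A. u a *\<^sub>R a) = 0"
    unfolding convex_hull_finite[OF fin(1)] by auto
  obtain a0 where a0: "a0 \<in> A" "u a0 > 0"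
    using u(1,2) by (metis order_less_le sum.neutral zero_neq_one)
  \<comment> \<open>After rescaling, \<open>a0\<close> has weight 1, so its rounded weight is
    exactly \<open>q > 0\<close> and the integral relation is nontrivial.\<close>
  define \<theta> where "\<theta> a = u a / u a0" for a
  have \<theta>: "\<And>a. a \<in> A \<Longrightarrow> 0 \<le> \<theta> a" "\<theta> a0 = 1"
    using u a0 by (auto simp: \<theta>_def)
  have \<theta>0: "(\<Sum>a\<in>A. \<theta> a *\<^sub>R a) = 0"
  proof -
    have "(\<Sum>a\<in>A. \<theta> a *\<^sub>R a) = (1 / u a0) *\<^sub>R (\<Sum>a\<in>A. u a *\<^sub>R a)"
      by (simp add: \<theta>_def scaleR_sum_right)
    then show ?thesis using u by simp
  qed
  obtain f where f: "bij_betw f {..<card A} A"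
    using ex_bij_betw_nat_finite[OF fin(1)] by (auto simp: atLeast0LessThan)
  \<comment> \<open>\<open>C\<close> bounds the effect of unit errors in all weights on any
    functional in \<open>\<Psi>\<close>. With \<open>N > C\<close>, errors below
    \<open>1 / N\<close> change each value by less than 1.\<close>
  define C where "C = (\<Sum>\<psi>\<in>\<Psi>. \<Sum>a\<in>A. \<bar>\<psi> \<bullet> a\<bar>)"
  have C: "(\<Sum>a\<in>A. \<bar>\<psi> \<bullet> a\<bar>) \<le> C" if "\<psi> \<in> \<Psi>" for \<psi>
    unfolding C_def by (rule member_le_sum[OF that]) (auto intro: sum_nonneg fin)
  have "C \<ge> 0" unfolding C_def by (auto intro: sum_nonneg)
  obtain N :: nat where N: "real N > C" using reals_Archimedean2 by blast
  then have "N > 0" using \<open>C \<ge> 0\<close> by (cases N) auto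
  obtain q p where q: "0 < q" and
    p: "\<And>i. i < card A \<Longrightarrow> \<bar>of_int q * (\<theta> \<circ> f) i - of_int (p i)\<bar> < 1 / N"
    using Dirichlet_approx_ex[OF \<open>N > 0\<close>, of "card A" "\<theta> \<circ> f"] by blast
  define r where "r = p \<circ> the_inv_into {..<card A} f"
  have r: "\<bar>of_int q * \<theta> a - of_int (r a)\<bar> < 1 / N" if "a \<in> A" for a
  proof -
    have "a \<in> f ` {..<card A}" using f that by (simp add: bij_betw_imp_surj_on)
    then obtain i where i: "i < card A" "a = f i" by blast
    have "the_inv_into {..<card A} f a = i"
      using f i by (simp add: bij_betw_def the_inv_into_f_f)
    then show ?thesis using p[OF i(1)] i by (simp add: r_def)
  qed
  have N1: "1 / N \<le> (1::real)" using \<open>N > 0\<close> by simp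
  have r0: "r a \<ge> 0" if "a \<in> A" for a
  proof -
    have "of_int q * \<theta> a \<ge> 0" using q \<theta>(1)[OF that] by simp
    then have "of_int (r a) > (-1 :: real)" using r[OF that] N1 by linarith
    then show ?thesis by linarith
  qed
  have "r a0 = q"
  proof -
    have "\<bar>of_int q - of_int (r a0)\<bar> < (1 :: real)" using r[OF a0(1)] \<theta>(2) N1 by simp
    then show ?thesis by linarith
  qed
  then have ra0: "r a0 > 0" using q by simp
  let ?w = "\<Sum>a\<in>A. of_int (r a) *\<^sub>R a"
  have "?w = 0"
  proof (rule sep)
    fix \<psi> assume \<psi>: "\<psi> \<in> \<Psi>"
    have eq: "\<psi> \<bullet> ?w = (\<Sum>a\<in>A. of_int (r a) * (\<psi> \<bullet> a))"
      by (simp add: inner_sum_right)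
    have "(\<Sum>a\<in>A. (of_int q * \<theta> a) * (\<psi> \<bullet> a)) = of_int q * (\<psi> \<bullet> (\<Sum>a\<in>A. \<theta> a *\<^sub>R a))"
      by (simp add: inner_sum_right sum_distrib_left mult.assoc)
    then have "\<psi> \<bullet> ?w = (\<Sum>a\<in>A. (of_int (r a) - of_int q * \<theta> a) * (\<psi> \<bullet> a))"
      using eq \<theta>0 by (simp add: algebra_simps sum_subtractf)
    then have "\<bar>\<psi> \<bullet> ?w\<bar> \<le> (\<Sum>a\<in>A. \<bar>(of_int (r a) - of_int q * \<theta> a) * (\<psi> \<bullet> a)\<bar>)"
      by (simp add: sum_abs)
    also have "\<dots> \<le> (\<Sum>a\<in>A. (1 / N) * \<bar>\<psi> \<bullet> a\<bar>)"
    proof (rule sum_mono)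
      fix a assume "a \<in> A"
      then have "\<bar>of_int (r a) - of_int q * \<theta> a\<bar> \<le> 1 / N"
        using r by (simp only: abs_minus_commute less_imp_le)
      then show "\<bar>(of_int (r a) - of_int q * \<theta> a) * (\<psi> \<bullet> a)\<bar> \<le> 1 / N * \<bar>\<psi> \<bullet> a\<bar>"
        unfolding abs_mult by (rule mult_right_mono) simp
    qed
    also have "\<dots> = (\<Sum>a\<in>A. \<bar>\<psi> \<bullet> a\<bar>) / N" by (simp add: sum_divide_distrib)
    also have "\<dots> < 1" using C[OF \<psi>] N \<open>N > 0\<close> by simp
    finally have "\<bar>\<psi> \<bullet> ?w\<bar> < 1" .
    moreover have "\<psi> \<bullet> ?w \<in> \<int>"
      unfolding eq using int \<psi> by (intro Ints_sum Ints_mult) auto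
    ultimately show "\<psi> \<bullet> ?w = 0" using Ints_nonzero_abs_less1 by blast
  qed
  define N' where "N' = (\<Sum>a\<in>A. replicate_mset (nat (r a)) a)"
  have mem: "a \<in># N' \<longleftrightarrow> a \<in> A \<and> nat (r a) > 0" for a
    using fin by (auto simp: N'_def set_mset_sum in_replicate_mset)
  have "\<Sum>\<^sub># N' = (\<Sum>a\<in>A. real (nat (r a)) *\<^sub>R a)"
    unfolding N'_def by (rule sum_mset_sum_replicate[OF fin(1)])
  also have "\<dots> = ?w" using r0 by (intro sum.cong) auto
  finally have "\<Sum>\<^sub># N' = 0" using \<open>?w = 0\<close> by simp
  moreover have "N' \<noteq> {#}" using mem[of a0] ra0 a0 by auto
  moreover have "set_mset N' \<subseteq> A" using mem by auto
  ultimately show thesis using that by blast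
qed

section \<open>Facets cut out by a hyperplane\<close>

text \<open>Points of \<open>W\<close> on the hyperplane are limits of points of \<open>R\<close>:
  shift them slightly along \<open>- a\<close>. So the supporting hyperplane meets the closure in a
  set containing a nonempty relatively open piece of itself, which has codimension one.\<close>

lemma facet_of_halfspace_cut:
  fixes a :: "'a::euclidean_space"
  assumes W: "open W" "convex W" and a: "a \<noteq> 0" and z: "z \<in> W" "a \<bullet> z = r"
    and R: "R = W \<inter> {x. a \<bullet> x < r}"
  shows "(closure R \<inter> {x. a \<bullet> x = r}) facet_of closure R"
proof -
  let ?H = "{x. a \<bullet> x = r}"
  have near: "w \<in> closure R" if w: "w \<in> W" "a \<bullet> w = r" for w
    unfolding closure_approachable
  proof (intro allI impI)
    fix e :: real assume "e > 0"
    obtain d where d: "d > 0" "ball w d \<subseteq> W" using W(1) w openE by blast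
    define t where "t = min d e / (2 * norm a)"
    have t: "t > 0" "t * norm a < d" "t * norm a < e"
      using d \<open>e > 0\<close> a by (auto simp: t_def)
    have dist: "dist (w - t *\<^sub>R a) w = t * norm a"
      using t by (simp add: dist_norm)
    then have "w - t *\<^sub>R a \<in> W" using d t by (auto simp: dist_commute)
    moreover have "t * (a \<bullet> a) > 0" using t a by simp
    then have "a \<bullet> (w - t *\<^sub>R a) < r" using w by (simp add: inner_diff_right)
    ultimately have "w - t *\<^sub>R a \<in> R" using R by blast
    moreover have "dist (w - t *\<^sub>R a) w < e" unfolding dist by (rule t)
    ultimately show "\<exists>y\<in>R. dist y w < e" by blast
  qed
  have "R \<noteq> {}" using near[OF z] by auto
  moreover have "open R" unfolding R by (intro open_Int W open_halfspace_lt)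
  ultimately have dimR: "aff_dim (closure R) = int DIM('a)"
    by (simp add: aff_dim_open)
  have "convex (closure R)"
    unfolding R by (intro convex_closure convex_Int W convex_halfspace_lt)
  moreover have "closure R \<subseteq> {x. a \<bullet> x \<le> r}"
    by (rule closure_minimal) (auto simp: R closed_halfspace_le)
  ultimately have face: "(closure R \<inter> ?H) face_of closure R"
    by (intro face_of_Int_supporting_hyperplane_le) auto
  have "aff_dim (?H \<inter> W) = aff_dim ?H"
    using W z by (intro aff_dim_convex_Int_open convex_hyperplane) auto
  moreover have "?H \<inter> W \<subseteq> closure R \<inter> ?H" using near by blast
  ultimately have "aff_dim (closure R \<inter> ?H) = aff_dim ?H"
    using aff_dim_subset[of "?H \<inter> W" "closure R \<inter> ?H"] aff_dim_subset[of "closure R \<inter> ?H" ?H] by simp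
  then have "aff_dim (closure R \<inter> ?H) = aff_dim (closure R) - 1"
    using dimR a by simp
  then show ?thesis using face near[OF z] z by (auto simp: facet_of_def)
qed

text \<open>Otherwise the facet would lie in a proper affine section of its own hyperplane and have
  codimension at least two.\<close>

lemma facet_determines_hyperplane:
  fixes a :: "'a::euclidean_space"
  assumes "open R" "R \<noteq> {}" "a \<noteq> 0" "(closure R \<inter> {x. a \<bullet> x = r}) facet_of closure R"
    and sub: "closure R \<inter> {x. a \<bullet> x = r} \<subseteq> {x. b \<bullet> x = s}"
  shows "{x. a \<bullet> x = r} \<subseteq> {x. b \<bullet> x = s}"
proof (rule ccontr)
  assume not: "\<not> ?thesis"
  let ?F = "closure R \<inter> {x. a \<bullet> x = r}"
  have F: "?F \<noteq> {}" "aff_dim ?F = int DIM('a) - 1"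
    using assms(4) aff_dim_open[OF assms(1,2)] by (auto simp: facet_of_def)
  have subI: "?F \<subseteq> {x. a \<bullet> x = r} \<inter> {x. b \<bullet> x = s}" using sub by blast
  then have "aff_dim ({x. a \<bullet> x = r} \<inter> {x. b \<bullet> x = s}) = aff_dim {x. a \<bullet> x = r} - 1"
    using F(1) not by (subst aff_dim_affine_Int_hyperplane) (auto simp: affine_hyperplane)
  then show False using aff_dim_subset[OF subI] F(2) assms(3) by simp
qed

section \<open>Root systems and the root poset\<close>

text \<open>The vector \<open>v\<close> serves as a height function: it is positive on
  \<open>P\<close>, hence strictly increasing along the root order, and it drives the inductions and
  the choice of maximal elements.\<close>

locale positive_roots =
  fixes \<Phi> P S :: "'a::euclidean_space set" and v :: 'a
  assumes crystallographic: "crystallographic_root_system \<Phi>"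
    and regular: "\<And>\<alpha>. \<alpha> \<in> \<Phi> \<Longrightarrow> v \<bullet> \<alpha> \<noteq> 0"
    and positive_def: "P = {\<alpha> \<in> \<Phi>. v \<bullet> \<alpha> > 0}"
    and simple: "simple_system P S"
begin

lemma finite_roots: "finite \<Phi>" and span_roots: "span \<Phi> = UNIV"
  and root_nonzero: "\<alpha> \<in> \<Phi> \<Longrightarrow> \<alpha> \<noteq> 0"
  and root_multiple: "\<alpha> \<in> \<Phi> \<Longrightarrow> c *\<^sub>R \<alpha> \<in> \<Phi> \<longleftrightarrow> c = 1 \<or> c = -1"
  and reflection: "\<alpha> \<in> \<Phi> \<Longrightarrow> \<beta> \<in> \<Phi> \<Longrightarrow> \<beta> - (2 * (\<beta> \<bullet> \<alpha>) / (\<alpha> \<bullet> \<alpha>)) *\<^sub>R \<alpha> \<in> \<Phi>"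
  and cartan_int: "\<alpha> \<in> \<Phi> \<Longrightarrow> \<beta> \<in> \<Phi> \<Longrightarrow> 2 * (\<beta> \<bullet> \<alpha>) / (\<alpha> \<bullet> \<alpha>) \<in> \<int>"
  using crystallographic unfolding crystallographic_root_system_def by auto

lemma uminus_root: "\<alpha> \<in> \<Phi> \<Longrightarrow> - \<alpha> \<in> \<Phi>"
  using root_multiple[of \<alpha> "-1"] by simp

lemma positive_roots: "P \<subseteq> \<Phi>" "finite P"
  using finite_roots by (auto simp: positive_def)

lemma positive_root_pos: "\<alpha> \<in> P \<Longrightarrow> v \<bullet> \<alpha> > 0"
  by (simp add: positive_def)

lemma positive_root_nonzero: "\<alpha> \<in> P \<Longrightarrow> \<alpha> \<noteq> 0"
  using root_nonzero positive_roots by blast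

lemma positive_or_negative: "\<alpha> \<in> \<Phi> \<Longrightarrow> \<alpha> \<in> P \<or> - \<alpha> \<in> P"
  using regular[of \<alpha>] uminus_root[of \<alpha>] by (auto simp: positive_def)

lemma simple_positive: "S \<subseteq> P" and simple_independent: "independent S"
  using simple by (auto simp: simple_system_def)

lemma finite_simple: "finite S"
  using simple_positive positive_roots finite_subset by blast

lemma positive_parallel:
  assumes "\<alpha> \<in> P" "c *\<^sub>R \<alpha> \<in> P"
  shows "c = 1"
  using assms root_multiple[of \<alpha> c] by (auto simp: positive_def)

text \<open>Both Cartan integers are positive. If one equals 1, a reflection produces the difference
  up to sign; if both are at least 2, the squared norm of \<alpha> - \<beta> is at most 0,
  contradicting distinctness.\<close>

lemma root_diff:
  assumes \<alpha>: "\<alpha> \<in> \<Phi>" and \<beta>: "\<beta> \<in> \<Phi>" and pos: "\<alpha> \<bullet> \<beta> > 0" and "\<alpha> \<noteq> \<beta>"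
  shows "\<alpha> - \<beta> \<in> \<Phi>"
proof -
  have aa: "\<alpha> \<bullet> \<alpha> > 0" and bb: "\<beta> \<bullet> \<beta> > 0"
    using root_nonzero \<alpha> \<beta> by auto
  obtain m n :: int where m: "2 * (\<beta> \<bullet> \<alpha>) / (\<alpha> \<bullet> \<alpha>) = of_int m" and n: "2 * (\<alpha> \<bullet> \<beta>) / (\<beta> \<bullet> \<beta>) = of_int n"
    using cartan_int[OF \<alpha> \<beta>] cartan_int[OF \<beta> \<alpha>] by (auto elim!: Ints_cases)
  have "real_of_int m > 0" "real_of_int n > 0"
    unfolding m[symmetric] n[symmetric] using aa bb pos by (auto simp: inner_commute)
  then have mn: "m \<ge> 1" "n \<ge> 1" by linarith+
  consider "m = 1" | "n = 1" | "m \<ge> 2" "n \<ge> 2" using mn by linarith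
  then show ?thesis
  proof cases
    case 1
    then have "\<beta> - \<alpha> \<in> \<Phi>" using reflection[OF \<alpha> \<beta>] m by simp
    then show ?thesis using uminus_root by fastforce
  next
    case 2
    then show ?thesis using reflection[OF \<beta> \<alpha>] n by simp
  next
    case 3
    have "2 * (\<beta> \<bullet> \<alpha>) \<ge> 2 * (\<alpha> \<bullet> \<alpha>)" "2 * (\<alpha> \<bullet> \<beta>) \<ge> 2 * (\<beta> \<bullet> \<beta>)"
      using m n 3 aa bb by (auto simp: field_simps)
    then have "(\<alpha> - \<beta>) \<bullet> (\<alpha> - \<beta>) \<le> 0"
      by (simp add: inner_diff_left inner_diff_right inner_commute)
    then have "(\<alpha> - \<beta>) \<bullet> (\<alpha> - \<beta>) = 0" by (intro antisym inner_ge_zero)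
    then show ?thesis using \<open>\<alpha> \<noteq> \<beta>\<close> by simp
  qed
qed

section \<open>The root order\<close>

lemma root_le_refl: "root_le S \<alpha> \<alpha>"
  unfolding root_le_def by (rule exI[of _ "\<lambda>_. 0"]) simp

lemma root_le_trans: "root_le S \<alpha> \<beta> \<Longrightarrow> root_le S \<beta> \<gamma> \<Longrightarrow> root_le S \<alpha> \<gamma>"
proof -
  assume "root_le S \<alpha> \<beta>" "root_le S \<beta> \<gamma>"
  then obtain c d :: "'a \<Rightarrow> nat" where "\<beta> - \<alpha> = (\<Sum>s\<in>S. of_nat (c s) *\<^sub>R s)" "\<gamma> - \<beta> = (\<Sum>s\<in>S. of_nat (d s) *\<^sub>R s)"
    unfolding root_le_def by blast
  then have "\<gamma> - \<alpha> = (\<Sum>s\<in>S. of_nat (d s + c s) *\<^sub>R s)"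
    by (simp add: scaleR_add_left sum.distrib flip: \<open>\<beta> - \<alpha> = _\<close> \<open>\<gamma> - \<beta> = _\<close>)
  then show ?thesis unfolding root_le_def by (intro exI[of _ "\<lambda>s. d s + c s"])
qed

lemma root_le_inner_mono:
  assumes "root_le S \<alpha> \<beta>" "\<And>s. s \<in> S \<Longrightarrow> x \<bullet> s \<ge> 0"
  shows "x \<bullet> \<alpha> \<le> x \<bullet> \<beta>"
proof -
  obtain c :: "'a \<Rightarrow> nat" where c: "\<beta> - \<alpha> = (\<Sum>s\<in>S. of_nat (c s) *\<^sub>R s)"
    using assms unfolding root_le_def by blast
  have "x \<bullet> (\<beta> - \<alpha>) \<ge> 0" unfolding c inner_sum_right using assms(2) by (auto intro!: sum_nonneg)
  then show ?thesis by (simp add: inner_diff_right)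
qed

lemma root_le_eqI:
  assumes "root_le S \<alpha> \<beta>" "v \<bullet> \<beta> \<le> v \<bullet> \<alpha>"
  shows "\<alpha> = \<beta>"
proof -
  obtain c :: "'a \<Rightarrow> nat" where c: "\<beta> - \<alpha> = (\<Sum>s\<in>S. of_nat (c s) *\<^sub>R s)"
    using assms unfolding root_le_def by blast
  have vs: "v \<bullet> s > 0" if "s \<in> S" for s using that simple_positive positive_root_pos by blast
  have "v \<bullet> (\<beta> - \<alpha>) = 0"
    using root_le_inner_mono[OF assms(1), of v] assms(2) vs by (force simp: inner_diff_right)
  then have "(\<Sum>s\<in>S. of_nat (c s) * (v \<bullet> s)) = 0" unfolding c by (simp add: inner_sum_right)
  then have "\<forall>s\<in>S. of_nat (c s) * (v \<bullet> s) = 0"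
    using vs finite_simple by (subst (asm) sum_nonneg_eq_0_iff) (auto simp: less_imp_le)
  then have "\<forall>s\<in>S. c s = 0" using vs by fastforce
  then show ?thesis using c by simp
qed

lemma root_le_antisym:
  assumes "root_le S \<alpha> \<beta>" "root_le S \<beta> \<alpha>"
  shows "\<alpha> = \<beta>"
proof (rule root_le_eqI[OF assms(1) root_le_inner_mono[OF assms(2)]])
  show "v \<bullet> s \<ge> 0" if "s \<in> S" for s
    using that simple_positive positive_root_pos less_imp_le by blast
qed

lemma sum_simple_delta:
  assumes "s \<in> S"
  shows "(\<Sum>t\<in>S. (if t = s then 1 else 0) *\<^sub>R t) = s"
proof -
  have "(\<Sum>t\<in>S. (if t = s then 1 else 0) *\<^sub>R t) = (\<Sum>t\<in>S. if t = s then t else 0)"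
    by (intro sum.cong) auto
  then show ?thesis using assms finite_simple by simp
qed

lemma root_le_add_simple:
  assumes "s \<in> S"
  shows "root_le S \<alpha> (\<alpha> + s)"
proof -
  have "\<alpha> + s - \<alpha> = (\<Sum>t\<in>S. of_nat (if t = s then 1 else 0) *\<^sub>R t)"
    using sum_simple_delta[OF assms] by (simp add: if_distrib[of real] cong: if_cong)
  then show ?thesis
    unfolding root_le_def by (intro exI[of _ "\<lambda>t. if t = s then 1 else 0"])
qed

text \<open>A simple root is not a sum of two positive roots; the conclusion is the form in which
  the contradiction is used. By independence, the nonnegative coordinates of \<alpha> and
  \<open>s - \<alpha>\<close> away from \<open>s\<close> must cancel and hence vanish, so \<alpha>
  is a multiple of \<open>s\<close>.\<close>

lemma simple_if_diff_positive:
  assumes "\<alpha> \<in> P" "s \<in> S" "s - \<alpha> \<in> P"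
  shows "\<alpha> = s"
proof -
  obtain c where c: "\<And>t. t \<in> S \<Longrightarrow> c t \<ge> (0::real)" "\<alpha> = (\<Sum>t\<in>S. c t *\<^sub>R t)"
    using simple assms(1) unfolding simple_system_def by metis
  obtain d where d: "\<And>t. t \<in> S \<Longrightarrow> d t \<ge> (0::real)" "s - \<alpha> = (\<Sum>t\<in>S. d t *\<^sub>R t)"
    using simple assms(3) unfolding simple_system_def by metis
  note delta = sum_simple_delta[OF assms(2)]
  have "(\<Sum>t\<in>S. (c t + d t - (if t = s then 1 else 0)) *\<^sub>R t) = \<alpha> + (s - \<alpha>) - s"
    unfolding d(2) unfolding c(2) scaleR_diff_left scaleR_add_left sum_subtractf sum.distrib delta ..
  then have "(\<Sum>t\<in>S. (c t + d t - (if t = s then 1 else 0)) *\<^sub>R t) = 0"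
    by simp
  then have "c t + d t = (if t = s then 1 else 0)" if "t \<in> S" for t
    using independentD[OF simple_independent finite_simple order_refl, of "\<lambda>t. c t + d t - (if t = s then 1 else 0)"] that by fastforce
  then have "c t = 0" if "t \<in> S" "t \<noteq> s" for t using c(1) d(1) that by force
  then have "(\<Sum>t\<in>S. c t *\<^sub>R t) = (\<Sum>t\<in>S. if t = s then c t *\<^sub>R t else 0)"
    by (intro sum.cong) auto
  then have "\<alpha> = c s *\<^sub>R s" using c(2) finite_simple assms(2) by simp
  then show ?thesis using positive_parallel[of s "c s"] assms simple_positive by auto
qed

text \<open>A simple system provides only real coefficients, whereas \<open>root_le\<close> asks for
  natural ones. Since \<alpha> has positive inner product with itself, it has one with some simple
  \<open>s\<close>; then \<open>\<alpha> - s\<close> is a positive root of smaller height unless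
  \<alpha> is simple.\<close>

lemma zero_root_le: "\<alpha> \<in> P \<Longrightarrow> root_le S 0 \<alpha>"
proof (induction "card {\<beta> \<in> P. v \<bullet> \<beta> < v \<bullet> \<alpha>}" arbitrary: \<alpha> rule: less_induct)
  case less
  show ?case
  proof (cases "\<alpha> \<in> S")
    case True
    then show ?thesis using root_le_add_simple[of \<alpha> 0] by simp
  next
    case False
    obtain c where c: "\<And>s. s \<in> S \<Longrightarrow> c s \<ge> (0::real)" "\<alpha> = (\<Sum>s\<in>S. c s *\<^sub>R s)"
      using simple less.prems unfolding simple_system_def by metis
    have "\<alpha> \<bullet> \<alpha> > 0" using positive_root_nonzero less.prems by simp
    also have "\<alpha> \<bullet> \<alpha> = (\<Sum>s\<in>S. c s * (\<alpha> \<bullet> s))"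
      by (subst (2) c(2)) (simp add: inner_sum_right)
    finally obtain s where s: "s \<in> S" "c s * (\<alpha> \<bullet> s) > 0"
      by (meson sum_nonpos not_le)
    have "\<alpha> \<bullet> s > 0" using s c(1)[OF s(1)] by (simp add: zero_less_mult_iff)
    moreover have "\<alpha> \<noteq> s" using False s by blast
    ultimately have "\<alpha> - s \<in> \<Phi>"
      using root_diff less.prems s simple_positive positive_roots by blast
    then have *: "\<alpha> - s \<in> P"
      using positive_or_negative[of "\<alpha> - s"] simple_if_diff_positive[of \<alpha> s] \<open>\<alpha> \<noteq> s\<close> less.prems s(1) by auto
    have vs: "v \<bullet> s > 0" using s simple_positive positive_root_pos by blast
    have lt: "v \<bullet> (\<alpha> - s) < v \<bullet> \<alpha>" using vs by (simp add: inner_diff_right)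
    have "{\<beta> \<in> P. v \<bullet> \<beta> < v \<bullet> (\<alpha> - s)} \<subset> {\<beta> \<in> P. v \<bullet> \<beta> < v \<bullet> \<alpha>}"
    proof (rule psubsetI)
      show "{\<beta> \<in> P. v \<bullet> \<beta> < v \<bullet> (\<alpha> - s)} \<subseteq> {\<beta> \<in> P. v \<bullet> \<beta> < v \<bullet> \<alpha>}"
        using less_trans[OF _ lt] by blast
      have "\<alpha> - s \<in> {\<beta> \<in> P. v \<bullet> \<beta> < v \<bullet> \<alpha>}" using * lt by blast
      then show "{\<beta> \<in> P. v \<bullet> \<beta> < v \<bullet> (\<alpha> - s)} \<noteq> {\<beta> \<in> P. v \<bullet> \<beta> < v \<bullet> \<alpha>}" by blast
    qed
    then have "card {\<beta> \<in> P. v \<bullet> \<beta> < v \<bullet> (\<alpha> - s)} < card {\<beta> \<in> P. v \<bullet> \<beta> < v \<bullet> \<alpha>}"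
      using positive_roots(2) by (intro psubset_card_mono) auto
    then have "root_le S 0 (\<alpha> - s)" using less.hyps * by blast
    then show ?thesis using root_le_add_simple[OF s(1), of "\<alpha> - s"] root_le_trans[of 0 "\<alpha> - s" \<alpha>] by simp
  qed
qed

lemma root_le_if_diff_positive: "\<beta> - \<alpha> \<in> P \<Longrightarrow> root_le S \<alpha> \<beta>"
  using zero_root_le[of "\<beta> - \<alpha>"] by (simp add: root_le_def)

section \<open>Additive relations between positive roots\<close>

lemma empty_if_sum_zero:
  assumes "set_mset B \<subseteq> P" "set_mset E \<subseteq> P" "\<Sum>\<^sub># B + \<Sum>\<^sub># E = 0"
  shows "B = {#} \<and> E = {#}"
proof (rule ccontr)
  assume "\<not> ?thesis"
  then have "(\<Sum>x\<in>#B + E. v \<bullet> x) > 0"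
    using assms positive_root_pos by (intro sum_mset_pos) auto
  then have "v \<bullet> (\<Sum>\<^sub># B + \<Sum>\<^sub># E) > 0"
    using inner_sum_mset_left[of "B + E" v] by (simp add: inner_commute)
  then show False using assms by simp
qed

text \<open>Some \<open>\<gamma>\<close> in \<open>G\<close> has
  positive inner product with the common sum, hence with some root \<open>\<delta>\<close> on the left, so \<open>\<gamma> - \<delta>\<close> is a root or zero, and
  cancelling it reduces the total number of roots.\<close>

lemma size_less_if_sum_eq:
  assumes ideal: "root_ideal P S I"
    and "set_mset B \<subseteq> P - I" "set_mset E \<subseteq> P" "set_mset G \<subseteq> I" "G \<noteq> {#}"
    and "\<Sum>\<^sub># B + \<Sum>\<^sub># E = \<Sum>\<^sub># G"
  shows "size B < size G"
  using assms(2-)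
proof (induction "size B + size E + size G" arbitrary: B E G rule: less_induct)
  case less
  have IP: "I \<subseteq> P" and down: "\<And>\<alpha> \<beta>. \<beta> \<in> I \<Longrightarrow> \<alpha> \<in> P \<Longrightarrow> root_le S \<alpha> \<beta> \<Longrightarrow> \<alpha> \<in> I"
    using ideal by (auto simp: root_ideal_def)
  define w where "w = \<Sum>\<^sub># G"
  have "w \<noteq> 0" using empty_if_sum_zero[of G "{#}"] less.prems IP by (auto simp: w_def)
  then have "w \<bullet> w > 0" by simp
  moreover have "w \<bullet> w = (\<Sum>x\<in>#G. x \<bullet> w)" by (simp only: w_def inner_sum_mset_left)
  ultimately have "(\<Sum>x\<in>#G. x \<bullet> w) > 0" by (rule ord_less_eq_trans)
  then obtain \<gamma> where \<gamma>: "\<gamma> \<in># G" "\<gamma> \<bullet> w > 0" by (rule sum_mset_pos_obtain)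
  have "(\<Sum>x\<in>#B + E. x \<bullet> \<gamma>) > 0"
    using inner_sum_mset_left[of "B + E" \<gamma>] \<gamma>(2) less.prems by (simp add: w_def inner_commute)
  then obtain \<delta> where \<delta>: "\<delta> \<in># B + E" "\<delta> \<bullet> \<gamma> > 0" by (rule sum_mset_pos_obtain)
  obtain G' where G': "G = add_mset \<gamma> G'" using \<gamma>(1) by (metis insert_DiffM)
  have \<gamma>I: "\<gamma> \<in> I" "\<gamma> \<in> P" and G'I: "set_mset G' \<subseteq> I" using less.prems G' IP by auto
  have diff: "\<delta> = \<gamma> \<or> \<gamma> - \<delta> \<in> P \<or> \<delta> - \<gamma> \<in> P" if "\<delta> \<in> P"
    using root_diff[of \<delta> \<gamma>] that \<delta>(2) \<gamma>I positive_roots positive_or_negative[of "\<delta> - \<gamma>"] by auto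
  show ?case
  proof (cases "\<delta> \<in># B")
    case True
    then obtain B' where B': "B = add_mset \<delta> B'" by (metis insert_DiffM)
    then have "\<delta> \<in> P" "\<delta> \<notin> I" using less.prems by auto
    \<comment> \<open>In the other two cases \<delta> would lie below \<gamma> and hence in the
      ideal. The difference moves to \<open>E\<close>, while \<open>B\<close> and \<open>G\<close>
      each lose one root, so the comparison of their sizes is preserved.\<close>
    then have d: "\<delta> - \<gamma> \<in> P"
      using diff down[OF \<gamma>I(1)] root_le_if_diff_positive \<gamma>I by blast
    have eq: "\<Sum>\<^sub># B' + \<Sum>\<^sub># (add_mset (\<delta> - \<gamma>) E) = \<Sum>\<^sub># G'"
      using less.prems(5) B' G' by (simp add: algebra_simps)
    have "G' \<noteq> {#}"
    proof
      assume "G' = {#}"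
      then show False using empty_if_sum_zero[of B' "add_mset (\<delta> - \<gamma>) E"] eq d B' less.prems by auto
    qed
    then have "size B' < size G'"
      using less.hyps[of B' "add_mset (\<delta> - \<gamma>) E" G'] eq d less.prems B' G' G'I by auto
    then show ?thesis using B' G' by simp
  next
    case False
    then have "\<delta> \<in># E" using \<delta> by simp
    then obtain E' where E': "E = add_mset \<delta> E'" by (metis insert_DiffM)
    then have "\<delta> \<in> P" using less.prems by auto
    \<comment> \<open>Covers the cases where \<gamma> disappears from \<open>G\<close> while
      \<open>B\<close> is kept and \<open>E\<close> does not grow. If nothing remains of
      \<open>G\<close>, the left side has sum zero and \<open>B\<close> is empty.\<close>
    have shrink: "size B < size G" if "\<Sum>\<^sub># B + \<Sum>\<^sub># E'' = \<Sum>\<^sub># G'" "set_mset E'' \<subseteq> P" "size E'' \<le> size E" for E''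
    proof (cases "G' = {#}")
      case True
      then have "B = {#}" using empty_if_sum_zero[of B E''] that less.prems by auto
      then show ?thesis using G' by simp
    next
      case False
      have "size B < size G'"
        using less.hyps[of B E'' G'] that False less.prems G' G'I by auto
      then show ?thesis using G' by simp
    qed
    from diff[OF \<open>\<delta> \<in> P\<close>] show ?thesis
    proof (elim disjE)
      assume "\<delta> = \<gamma>"
      then show ?thesis using shrink[of E'] less.prems E' G' by auto
    next
      assume d: "\<delta> - \<gamma> \<in> P"
      show ?thesis using shrink[of "add_mset (\<delta> - \<gamma>) E'"] less.prems E' G' d by (auto simp: algebra_simps)
    next
      assume d: "\<gamma> - \<delta> \<in> P"
      \<comment> \<open>Here \<gamma> is replaced by a smaller element of the ideal:
        \<open>G\<close> keeps its size and only \<open>E\<close> shrinks.\<close>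
      then have "root_le S (\<gamma> - \<delta>) \<gamma>" using root_le_if_diff_positive[of \<gamma> "\<gamma> - \<delta>"] \<open>\<delta> \<in> P\<close> by simp
      then have "\<gamma> - \<delta> \<in> I" using down \<gamma>I d by blast
      then have "size B < size (add_mset (\<gamma> - \<delta>) G')"
        using less.hyps[of B E' "add_mset (\<gamma> - \<delta>) G'"] less.prems E' G' G'I by (auto simp: algebra_simps)
      then show ?thesis using G' by simp
    qed
  qed
qed

section \<open>Dominant regions and ideals\<close>

text \<open>Two independent index sets allow the side of a single hyperplane to be left open, which
  yields a convex set containing two adjacent cells.\<close>

definition wedge :: "'a set \<Rightarrow> 'a set \<Rightarrow> 'a set" where
  "wedge J K = {x. (\<forall>\<alpha>\<in>P. x \<bullet> \<alpha> > 0) \<and> (\<forall>\<alpha>\<in>J. x \<bullet> \<alpha> < 1) \<and> (\<forall>\<alpha>\<in>K. x \<bullet> \<alpha> > 1)}"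

abbreviation cell :: "'a set \<Rightarrow> 'a set" where
  "cell J \<equiv> wedge J (P - J)"

lemma orthogonal_roots_zero:
  assumes "\<And>\<alpha>. \<alpha> \<in> \<Phi> \<Longrightarrow> \<alpha> \<bullet> w = 0"
  shows "w = 0"
proof -
  have "w \<in> span \<Phi>" using span_roots by simp
  moreover have "orthogonal w x" if "x \<in> \<Phi>" for x
    using assms[OF that] by (simp add: orthogonal_def inner_commute)
  ultimately have "orthogonal w w" using orthogonal_to_span by blast
  then show ?thesis by (simp add: orthogonal_def)
qed

text \<open>Homogenising with an extra coordinate \<open>t > 0\<close> turns the defining inequalities of the cell into
  an instance of Gordan's alternative.\<close>

lemma cell_nonempty:
  assumes J: "root_ideal P S J"
  shows "cell J \<noteq> {}"
proof
  assume empty: "cell J = {}"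
  have JP: "J \<subseteq> P" using J by (simp add: root_ideal_def)
  \<comment> \<open>Positivity of \<open>(x, t)\<close> on these vectors means, in order: values
    above \<open>t\<close> outside \<open>J\<close>, values below \<open>t\<close> on
    \<open>J\<close>, dominance, and \<open>t > 0\<close>.\<close>
  define A :: "('a \<times> real) set" where
    "A = (\<lambda>\<beta>. (\<beta>, -1)) ` (P - J) \<union> (\<lambda>\<gamma>. (- \<gamma>, 1)) ` J \<union> (\<lambda>\<alpha>. (\<alpha>, 0)) ` P \<union> {(0, 1)}"
  \<comment> \<open>Coroots together with the last coordinate: integral on \<open>A\<close> by the
    Cartan integers, and separating points because the roots span.\<close>
  define \<Psi> :: "('a \<times> real) set" where
    "\<Psi> = (\<lambda>\<alpha>. ((2 / (\<alpha> \<bullet> \<alpha>)) *\<^sub>R \<alpha>, 0)) ` \<Phi> \<union> {(0, 1)}"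
  \<comment> \<open>The members of \<open>N\<close> are sorted by the four kinds of vectors in
    \<open>A\<close>; the last coordinate of the sum counts them with signs.\<close>
  have decompose: "\<exists>B E G k. set_mset B \<subseteq> P - J \<and> set_mset E \<subseteq> P \<and> set_mset G \<subseteq> J \<and>
      \<Sum>\<^sub># N = (\<Sum>\<^sub># B + \<Sum>\<^sub># E - \<Sum>\<^sub># G, real (size G) + real k - real (size B)) \<and>
      size N = size B + size E + size G + k" if "set_mset N \<subseteq> A" for N
    using that
  proof (induction N)
    case empty
    show ?case
      by (rule exI[of _ "{#}"], rule exI[of _ "{#}"], rule exI[of _ "{#}"], rule exI[of _ 0])
        (simp add: zero_prod_def)
  next
    case (add a N)
    then obtain B E G k where IH: "set_mset B \<subseteq> P - J" "set_mset E \<subseteq> P" "set_mset G \<subseteq> J"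
      "\<Sum>\<^sub># N = (\<Sum>\<^sub># B + \<Sum>\<^sub># E - \<Sum>\<^sub># G, real (size G) + real k - real (size B))"
      "size N = size B + size E + size G + k" by auto
    from add.prems consider \<beta> where "\<beta> \<in> P - J" "a = (\<beta>, -1)" | \<gamma> where "\<gamma> \<in> J" "a = (- \<gamma>, 1)"
      | \<alpha> where "\<alpha> \<in> P" "a = (\<alpha>, 0)" | "a = (0, 1)"
      unfolding A_def by auto
    then show ?case
    proof cases
      case 1
      then show ?thesis using IH
        by (intro exI[of _ "add_mset \<beta> B"] exI[of _ E] exI[of _ G] exI[of _ k]) simp
    next
      case 2
      then show ?thesis using IH
        by (intro exI[of _ B] exI[of _ E] exI[of _ "add_mset \<gamma> G"] exI[of _ k]) simp
    next
      case 3
      then show ?thesis using IH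
        by (intro exI[of _ B] exI[of _ "add_mset \<alpha> E"] exI[of _ G] exI[of _ k]) simp
    next
      case 4
      then show ?thesis using IH
        by (intro exI[of _ B] exI[of _ E] exI[of _ G] exI[of _ "Suc k"]) simp
    qed
  qed
  have "finite J" using JP positive_roots(2) finite_subset by blast
  then have "finite A" "finite \<Psi>"
    using positive_roots(2) finite_roots by (simp_all add: A_def \<Psi>_def)
  moreover have "\<psi> \<bullet> a \<in> \<int>" if "a \<in> A" "\<psi> \<in> \<Psi>" for a \<psi>
  proof -
    have cartan: "2 * (\<alpha> \<bullet> \<beta>) / (\<alpha> \<bullet> \<alpha>) \<in> \<int>" if "\<alpha> \<in> \<Phi>" "\<beta> \<in> P" for \<alpha> \<beta>
      using cartan_int[of \<alpha> \<beta>] that positive_roots(1) by (auto simp: inner_commute)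
    from that(2) consider \<alpha> where "\<alpha> \<in> \<Phi>" "\<psi> = ((2 / (\<alpha> \<bullet> \<alpha>)) *\<^sub>R \<alpha>, 0)" | "\<psi> = (0, 1)"
      unfolding \<Psi>_def by auto
    then show ?thesis
    proof cases
      case 1
      from that(1) have "fst a = 0 \<or> fst a \<in> P \<or> - fst a \<in> P" unfolding A_def using JP by auto
      then have "2 * (\<alpha> \<bullet> fst a) / (\<alpha> \<bullet> \<alpha>) \<in> \<int>"
      proof (elim disjE)
        assume "- fst a \<in> P"
        then show ?thesis using cartan[OF 1(1), of "- fst a"] by (simp add: minus_in_Ints_iff)
      qed (use cartan[OF 1(1)] in auto)
      then show ?thesis using 1(2) by (cases a) (simp add: inner_Pair)
    next
      case 2
      then show ?thesis using that(1) unfolding A_def by (auto simp: inner_Pair)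
    qed
  qed
  moreover have "w = 0" if "\<And>\<psi>. \<psi> \<in> \<Psi> \<Longrightarrow> \<psi> \<bullet> w = 0" for w
  proof -
    note orth = that
    have "snd w = 0" using orth[of "(0, 1)"] by (cases w) (simp add: \<Psi>_def inner_Pair)
    moreover have "\<alpha> \<bullet> fst w = 0" if \<alpha>: "\<alpha> \<in> \<Phi>" for \<alpha>
      using orth[of "((2 / (\<alpha> \<bullet> \<alpha>)) *\<^sub>R \<alpha>, 0)"] \<alpha> root_nonzero[OF \<alpha>]
      by (cases w) (simp add: \<Psi>_def inner_Pair)
    ultimately show ?thesis using orthogonal_roots_zero by (simp add: prod_eq_iff)
  qed
  moreover have "\<nexists>x. \<forall>a\<in>A. x \<bullet> a > 0"
  proof
    assume "\<exists>x. \<forall>a\<in>A. x \<bullet> a > 0"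
    then obtain x t where xt: "\<And>a. a \<in> A \<Longrightarrow> (x, t) \<bullet> a > 0" by (metis surj_pair)
    have t: "t > 0" using xt[of "(0, 1)"] by (simp add: A_def inner_Pair)
    have "x \<bullet> \<alpha> > 0" if "\<alpha> \<in> P" for \<alpha>
      using xt[of "(\<alpha>, 0)"] that by (simp add: A_def inner_Pair)
    moreover have "x \<bullet> \<alpha> < t" if "\<alpha> \<in> J" for \<alpha>
      using xt[of "(- \<alpha>, 1)"] that by (simp add: A_def inner_Pair)
    moreover have "x \<bullet> \<alpha> > t" if "\<alpha> \<in> P - J" for \<alpha>
      using xt[of "(\<alpha>, -1)"] that by (simp add: A_def inner_Pair)
    ultimately have "(1 / t) *\<^sub>R x \<in> cell J"
      unfolding wedge_def using t by simp
    then show False using empty by simp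
  qed
  ultimately obtain N where N: "N \<noteq> {#}" "set_mset N \<subseteq> A" "\<Sum>\<^sub># N = 0"
    by (rule integral_gordan)
  obtain B E G k where *: "set_mset B \<subseteq> P - J" "set_mset E \<subseteq> P" "set_mset G \<subseteq> J"
      "\<Sum>\<^sub># N = (\<Sum>\<^sub># B + \<Sum>\<^sub># E - \<Sum>\<^sub># G, real (size G) + real k - real (size B))"
      "size N = size B + size E + size G + k"
    using decompose[OF N(2)] by blast
  have sums: "\<Sum>\<^sub># B + \<Sum>\<^sub># E = \<Sum>\<^sub># G" "size G + k = size B"
    using N(3) *(4) by (auto simp: zero_prod_def)
  \<comment> \<open>The last coordinate makes \<open>B\<close> at least as large as
    \<open>G\<close>, which the size bound forbids for nonempty \<open>G\<close>.\<close>
  then have "G = {#}" using size_less_if_sum_eq[OF J *(1-3)] by linarith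
  moreover from this have "B = {#} \<and> E = {#}"
    using empty_if_sum_zero[of B E] *(1,2) sums by auto
  ultimately show False using N(1) *(5) sums by simp
qed

section \<open>Cells as dominant regions\<close>

lemma wedge_eq_INT:
  "wedge J K = (\<Inter>\<alpha>\<in>P. {x. \<alpha> \<bullet> x > 0}) \<inter> (\<Inter>\<alpha>\<in>J. {x. \<alpha> \<bullet> x < 1}) \<inter> (\<Inter>\<alpha>\<in>K. {x. \<alpha> \<bullet> x > 1})"
  by (auto simp: wedge_def inner_commute)

lemma convex_wedge: "convex (wedge J K)"
  unfolding wedge_eq_INT by (intro convex_Int convex_INT convex_halfspace_lt convex_halfspace_gt)

lemma open_wedge: "J \<subseteq> P \<Longrightarrow> K \<subseteq> P \<Longrightarrow> open (wedge J K)"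
  unfolding wedge_eq_INT using positive_roots(2) finite_subset
  by (intro open_Int open_INT ballI open_halfspace_lt open_halfspace_gt) blast+

lemma in_complement_iff:
  "x \<in> - \<Union>(catalan_hyperplanes \<Phi>) \<longleftrightarrow> (\<forall>\<alpha>\<in>\<Phi>. x \<bullet> \<alpha> \<noteq> 0 \<and> x \<bullet> \<alpha> \<noteq> 1)"
  unfolding catalan_hyperplanes_def hyp_def by blast

lemma cell_subset_complement:
  assumes "J \<subseteq> P"
  shows "cell J \<subseteq> - \<Union>(catalan_hyperplanes \<Phi>)"
proof
  fix x assume x: "x \<in> cell J"
  have "x \<bullet> \<alpha> \<noteq> 0 \<and> x \<bullet> \<alpha> \<noteq> 1" if "\<alpha> \<in> \<Phi>" for \<alpha>
  proof (cases "\<alpha> \<in> P")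
    case True
    then show ?thesis using x by (cases "\<alpha> \<in> J") (force simp: wedge_def)+
  next
    case False
    then have "x \<bullet> (- \<alpha>) > 0" using positive_or_negative[OF that] x unfolding wedge_def by blast
    then show ?thesis by auto
  qed
  then show "x \<in> - \<Union>(catalan_hyperplanes \<Phi>)" unfolding in_complement_iff by blast
qed

lemma connected_same_side:
  assumes "connected T" "\<And>y. y \<in> T \<Longrightarrow> y \<bullet> \<alpha> \<noteq> r" "x \<in> T" "y \<in> T" "x \<bullet> \<alpha> < r"
  shows "y \<bullet> \<alpha> < r"
  using connected_ivt_hyperplane[OF assms(1,3,4), of \<alpha> r] assms by (force simp: inner_commute)

text \<open>By the intermediate value property, no root can cross the value 0 or 1 on a connected
  set avoiding the arrangement. This makes nonempty cells maximal connected subsets of the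
  complement.\<close>

lemma connected_subset_cell:
  assumes T: "connected T" "T \<subseteq> - \<Union>(catalan_hyperplanes \<Phi>)" and x: "x \<in> T" "x \<in> cell J" and J: "J \<subseteq> P"
  shows "T \<subseteq> cell J"
proof
  fix y assume y: "y \<in> T"
  have avoid: "z \<bullet> \<alpha> \<noteq> 0" "z \<bullet> \<alpha> \<noteq> 1" if "z \<in> T" "\<alpha> \<in> P" for z \<alpha>
    using that T(2) in_complement_iff positive_roots(1) by blast+
  have "y \<bullet> \<alpha> > 0" if "\<alpha> \<in> P" for \<alpha>
  proof -
    have "\<not> y \<bullet> \<alpha> < 0"
      using connected_same_side[OF T(1), of \<alpha> 0 y x] avoid(1) that x y by (force simp: wedge_def)
    then show ?thesis using avoid(1)[OF y that] by linarith
  qed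
  moreover have "y \<bullet> \<alpha> < 1" if "\<alpha> \<in> J" for \<alpha>
    using connected_same_side[OF T(1), of \<alpha> 1 x y] avoid(2) that x y J by (force simp: wedge_def)
  moreover have "y \<bullet> \<alpha> > 1" if "\<alpha> \<in> P - J" for \<alpha>
  proof -
    have "\<not> y \<bullet> \<alpha> < 1"
      using connected_same_side[OF T(1), of \<alpha> 1 y x] avoid(2) that x y by (force simp: wedge_def)
    then show ?thesis using avoid(2)[OF y, of \<alpha>] that by force
  qed
  ultimately show "y \<in> cell J" by (simp add: wedge_def)
qed

lemma cell_in_dominant_regions:
  assumes "J \<subseteq> P" "cell J \<noteq> {}"
  shows "cell J \<in> dominant_regions \<Phi> P"
proof -
  have "D = cell J" if "cell J \<subseteq> D" "D \<subseteq> - \<Union>(catalan_hyperplanes \<Phi>)" "connected D" for D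
    using connected_subset_cell[OF that(3,2)] assms that(1) by blast
  then have "cell J \<in> catalan_regions \<Phi>"
    unfolding catalan_regions_def in_components_maximal
    by (intro conjI assms(2) cell_subset_complement[OF assms(1)] convex_connected[OF convex_wedge])
      blast
  moreover have "dominant P (cell J)" by (simp add: dominant_def wedge_def)
  ultimately show ?thesis by (simp add: dominant_regions_def)
qed

lemma theta_cell:
  assumes "J \<subseteq> P" "cell J \<noteq> {}"
  shows "theta P (cell J) = J"
proof -
  obtain x where x: "x \<in> cell J" using assms by blast
  have "\<alpha> \<in> J" if "\<alpha> \<in> P" "x \<bullet> \<alpha> < 1" for \<alpha>
    using x that by (force simp: wedge_def)
  then show ?thesis using x assms(1) by (auto simp: theta_def wedge_def)
qed

text \<open>Reading off the roots with value below 1 at one sample point gives a cell containing the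
  region; maximality of components gives equality. Dominance makes values monotone in the root
  order, hence the ideal property.\<close>

lemma dominant_region_eq_cell:
  assumes R: "R \<in> dominant_regions \<Phi> P"
  shows "cell (theta P R) = R" "root_ideal P S (theta P R)"
proof -
  have comp: "R \<in> components (- \<Union>(catalan_hyperplanes \<Phi>))" and dom: "dominant P R"
    using R by (auto simp: dominant_regions_def catalan_regions_def)
  have R': "R \<noteq> {}" "connected R" "R \<subseteq> - \<Union>(catalan_hyperplanes \<Phi>)"
    using comp unfolding in_components_maximal by blast+
  then obtain x where x: "x \<in> R" by blast
  define J where "J = {\<alpha> \<in> P. x \<bullet> \<alpha> < 1}"
  have JP: "J \<subseteq> P" by (auto simp: J_def)
  have "x \<bullet> \<alpha> > 1" if "\<alpha> \<in> P - J" for \<alpha>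
  proof -
    have "x \<bullet> \<alpha> \<noteq> 1" using x R'(3) that positive_roots(1) in_complement_iff by blast
    then show ?thesis using that by (auto simp: J_def)
  qed
  then have xJ: "x \<in> cell J" using dom x by (auto simp: wedge_def J_def dominant_def)
  have "R \<subseteq> cell J" using connected_subset_cell[OF R'(2,3) x xJ JP] .
  moreover have "\<forall>D. D \<noteq> {} \<and> R \<subseteq> D \<and> D \<subseteq> - \<Union>(catalan_hyperplanes \<Phi>) \<and> connected D \<longrightarrow> D = R"
    using comp unfolding in_components_maximal by (elim conjE)
  moreover have "cell J \<noteq> {}" using xJ by blast
  ultimately have eq: "cell J = R"
    using cell_subset_complement[OF JP] convex_connected[OF convex_wedge[of J "P - J"]] by meson
  then have "theta P R = J" using theta_cell[OF JP] xJ by blast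
  then show "cell (theta P R) = R" using eq by simp
  show "root_ideal P S (theta P R)"
    unfolding root_ideal_def theta_def
  proof (intro conjI ballI impI)
    fix \<beta> \<alpha> assume "\<beta> \<in> {\<alpha> \<in> P. \<forall>x\<in>R. x \<bullet> \<alpha> < 1}" "\<alpha> \<in> P" "root_le S \<alpha> \<beta>"
    moreover have "y \<bullet> \<alpha> \<le> y \<bullet> \<beta>" if "y \<in> R" for y
      using root_le_inner_mono[OF \<open>root_le S \<alpha> \<beta>\<close>, of y] dom that simple_positive
      unfolding dominant_def by (meson less_imp_le subsetD)
    ultimately show "\<alpha> \<in> {\<alpha> \<in> P. \<forall>x\<in>R. x \<bullet> \<alpha> < 1}" using order.strict_trans1 by blast
  qed auto
qed

text \<open>\<open>theta\<close> is injective because a region is recovered as the cell of its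
  image, and nonemptiness of the cell makes it a preimage of \<open>J\<close>.\<close>

lemma theta_inv_eq_cell:
  assumes "root_ideal P S J"
  shows "theta_inv \<Phi> P J = cell J"
proof -
  have J: "J \<subseteq> P" "cell J \<noteq> {}" using assms cell_nonempty by (auto simp: root_ideal_def)
  have "inj_on (theta P) (dominant_regions \<Phi> P)"
    by (rule inj_onI) (metis dominant_region_eq_cell(1))
  then have "the_inv_into (dominant_regions \<Phi> P) (theta P) (theta P (cell J)) = cell J"
    using cell_in_dominant_regions[OF J] by (rule the_inv_into_f_f)
  then show ?thesis unfolding theta_inv_def theta_cell[OF J] .
qed

section \<open>Floors and ceilings\<close>

definition minimal_roots :: "'a set \<Rightarrow> 'a set" where
  "minimal_roots K = {\<gamma> \<in> K. \<forall>\<delta>\<in>K. root_le S \<delta> \<gamma> \<longrightarrow> \<delta> = \<gamma>}"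

definition maximal_roots :: "'a set \<Rightarrow> 'a set" where
  "maximal_roots K = {\<gamma> \<in> K. \<forall>\<delta>\<in>K. root_le S \<gamma> \<delta> \<longrightarrow> \<delta> = \<gamma>}"

text \<open>Moving from a point \<open>p\<close> of the first hyperplane by the component
  \<open>w\<close> of \<beta> orthogonal to \<alpha> stays in it, so \<beta> is orthogonal to
  \<open>w\<close>. Thus \<open>w = 0\<close>, and parallel positive roots coincide.\<close>

lemma hyp_subset_imp_eq:
  assumes "\<alpha> \<in> P" "\<beta> \<in> P" and sub: "hyp \<alpha> 1 \<subseteq> hyp \<beta> 1"
  shows "\<alpha> = \<beta>"
proof -
  have nz: "\<alpha> \<bullet> \<alpha> \<noteq> 0" using positive_root_nonzero assms(1) by simp
  define c where "c = (\<beta> \<bullet> \<alpha>) / (\<alpha> \<bullet> \<alpha>)"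
  define w where "w = \<beta> - c *\<^sub>R \<alpha>"
  define p where "p = (1 / (\<alpha> \<bullet> \<alpha>)) *\<^sub>R \<alpha>"
  have w\<alpha>: "w \<bullet> \<alpha> = 0" using nz by (simp add: w_def c_def inner_diff_left)
  have "p \<in> hyp \<alpha> 1" "p + w \<in> hyp \<alpha> 1"
    using nz w\<alpha> by (auto simp: hyp_def p_def inner_add_left)
  then have "p \<bullet> \<beta> = 1" "(p + w) \<bullet> \<beta> = 1" using sub by (auto simp: hyp_def)
  then have "w \<bullet> \<beta> = 0" by (simp add: inner_add_left)
  moreover have "w \<bullet> w = w \<bullet> \<beta> - c * (w \<bullet> \<alpha>)"
    by (subst (2) w_def) (simp add: inner_diff_right)
  ultimately have "w = 0" using w\<alpha> by simp
  then have "\<beta> = c *\<^sub>R \<alpha>" by (simp add: w_def)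
  then show ?thesis using positive_parallel[of \<alpha> c] assms by simp
qed

lemma hyp_inj: "inj_on (\<lambda>\<alpha>. hyp \<alpha> 1) P"
  by (rule inj_onI) (simp add: hyp_subset_imp_eq)

lemma hyp_eq: "hyp \<alpha> r = {x. \<alpha> \<bullet> x = r}"
  by (simp add: hyp_def inner_commute)

lemma wedge_insert_below: "wedge (insert \<alpha> J) K = wedge J K \<inter> {x. \<alpha> \<bullet> x < 1}"
  by (auto simp: wedge_def inner_commute)

text \<open>The negated form presents the upper side as a strict lower half-space, as
  \<open>facet_of_halfspace_cut\<close> expects.\<close>

lemma wedge_insert_above: "wedge J (insert \<alpha> K) = wedge J K \<inter> {x. (- \<alpha>) \<bullet> x < - 1}"
  by (auto simp: wedge_def inner_commute)

text \<open>Both \<open>J\<close> and \<open>J - {\<alpha>}\<close> have nonempty cells, and these differ only in the side of the hyperplane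
  \<open>H\<^sub>\<alpha>\<^sup>1\<close>; hence a segment joining them meets this hyperplane in the interior of a common facet.\<close>

lemma hyp_in_walls:
  assumes J: "root_ideal P S J" "root_ideal P S (J - {\<alpha>})" and \<alpha>: "\<alpha> \<in> J"
  shows "hyp \<alpha> 1 \<in> walls \<Phi> (cell J)" "hyp \<alpha> 1 \<in> walls \<Phi> (cell (J - {\<alpha>}))"
proof -
  have JP: "J \<subseteq> P" using J(1) by (simp add: root_ideal_def)
  then have \<alpha>P: "\<alpha> \<in> P" using \<alpha> by blast
  define W where "W = wedge (J - {\<alpha>}) (P - J)"
  have W: "open W" "convex W" unfolding W_def using JP by (simp_all add: open_wedge convex_wedge subset_iff)
  have "insert \<alpha> (J - {\<alpha>}) = J" "insert \<alpha> (P - J) = P - (J - {\<alpha>})" using \<alpha> \<alpha>P by auto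
  then have below: "cell J = W \<inter> {x. \<alpha> \<bullet> x < 1}"
    and above: "cell (J - {\<alpha>}) = W \<inter> {x. (- \<alpha>) \<bullet> x < - 1}"
    using wedge_insert_below[of \<alpha> "J - {\<alpha>}" "P - J"] wedge_insert_above[of "J - {\<alpha>}" \<alpha> "P - J"]
    by (simp_all only: W_def)
  obtain x y where "x \<in> cell J" "y \<in> cell (J - {\<alpha>})"
    using cell_nonempty[OF J(1)] cell_nonempty[OF J(2)] by auto
  then have "x \<in> W" "y \<in> W" "\<alpha> \<bullet> x \<le> 1" "\<alpha> \<bullet> y \<ge> 1" unfolding above below by auto
  then obtain z where z: "z \<in> W" "\<alpha> \<bullet> z = 1"
    using connected_ivt_hyperplane[OF convex_connected[OF W(2)], of x y \<alpha> 1] by blast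
  have nz: "\<alpha> \<noteq> 0" using positive_root_nonzero \<alpha>P .
  have H: "hyp \<alpha> 1 \<in> catalan_hyperplanes \<Phi>"
    unfolding catalan_hyperplanes_def using \<alpha>P positive_roots(1) by blast
  have "(closure (cell J) \<inter> hyp \<alpha> 1) facet_of closure (cell J)"
    using facet_of_halfspace_cut[OF W nz z below] by (simp add: hyp_eq)
  then show "hyp \<alpha> 1 \<in> walls \<Phi> (cell J)" using H by (simp add: walls_def)
  have "(closure (cell (J - {\<alpha>})) \<inter> {x. (- \<alpha>) \<bullet> x = - 1}) facet_of closure (cell (J - {\<alpha>}))"
    by (rule facet_of_halfspace_cut[OF W _ z(1) _ above]) (use nz z in auto)
  moreover have "{x. (- \<alpha>) \<bullet> x = - 1} = hyp \<alpha> 1" by (auto simp: hyp_eq)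
  ultimately have "(closure (cell (J - {\<alpha>})) \<inter> hyp \<alpha> 1) facet_of closure (cell (J - {\<alpha>}))"
    by simp
  then show "hyp \<alpha> 1 \<in> walls \<Phi> (cell (J - {\<alpha>}))" using H by (simp add: walls_def)
qed

lemma in_closure_wedge:
  assumes "x \<in> closure (wedge J K)"
  shows "\<alpha> \<in> P \<Longrightarrow> x \<bullet> \<alpha> \<ge> 0" "\<alpha> \<in> J \<Longrightarrow> x \<bullet> \<alpha> \<le> 1" "\<alpha> \<in> K \<Longrightarrow> x \<bullet> \<alpha> \<ge> 1"
proof -
  have cl: "x \<in> C" if "closed C" "wedge J K \<subseteq> C" for C
    using assms closure_minimal[OF that(2,1)] by blast
  show "x \<bullet> \<alpha> \<ge> 0" if "\<alpha> \<in> P"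
    using cl[OF closed_halfspace_ge[of 0 \<alpha>]] that by (force simp: wedge_def inner_commute)
  show "x \<bullet> \<alpha> \<le> 1" if "\<alpha> \<in> J"
    using cl[OF closed_halfspace_le[of \<alpha> 1]] that by (force simp: wedge_def inner_commute)
  show "x \<bullet> \<alpha> \<ge> 1" if "\<alpha> \<in> K"
    using cl[OF closed_halfspace_ge[of 1 \<alpha>]] that by (force simp: wedge_def inner_commute)
qed

text \<open>A negative root takes nonpositive values on the closure of a dominant cell, so it cannot
  take the value 1 at a point of the facet.\<close>

lemma wall_root:
  assumes H: "H \<in> walls \<Phi> (cell J)" "0 \<notin> H"
  obtains \<alpha> where "\<alpha> \<in> P" "H = hyp \<alpha> 1"
proof -
  obtain \<alpha> r where \<alpha>: "\<alpha> \<in> \<Phi>" "H = hyp \<alpha> r" "r = 0 \<or> r = 1"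
    using H(1) by (auto simp: walls_def catalan_hyperplanes_def)
  then have r: "r = 1" using H(2) by (auto simp: hyp_def)
  obtain x where x: "x \<in> closure (cell J)" "x \<in> H"
    using H(1) by (auto simp: walls_def facet_of_def)
  have "- \<alpha> \<notin> P"
    using in_closure_wedge(1)[OF x(1), of "- \<alpha>"] x(2) \<alpha> r by (auto simp: hyp_def)
  then have "\<alpha> \<in> P" using positive_or_negative[OF \<alpha>(1)] by simp
  then show thesis using that \<alpha>(2) r by simp
qed

lemma wall_root_unique:
  assumes J: "root_ideal P S J" and H: "hyp \<alpha> 1 \<in> walls \<Phi> (cell J)"
    and \<alpha>: "\<alpha> \<in> P" and \<beta>: "\<beta> \<in> P"
    and eq: "\<And>x. x \<in> closure (cell J) \<Longrightarrow> x \<bullet> \<alpha> = 1 \<Longrightarrow> x \<bullet> \<beta> = 1"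
  shows "\<beta> = \<alpha>"
proof -
  have "J \<subseteq> P" using J by (simp add: root_ideal_def)
  then have "open (cell J)" "cell J \<noteq> {}" using open_wedge cell_nonempty J by auto
  moreover have "\<alpha> \<noteq> 0" using positive_root_nonzero \<alpha> .
  moreover have "(closure (cell J) \<inter> {x. \<alpha> \<bullet> x = 1}) facet_of closure (cell J)"
    using H by (simp add: walls_def hyp_eq)
  moreover have "closure (cell J) \<inter> {x. \<alpha> \<bullet> x = 1} \<subseteq> {x. \<beta> \<bullet> x = 1}"
    using eq by (auto simp: inner_commute)
  ultimately have "{x. \<alpha> \<bullet> x = 1} \<subseteq> {x. \<beta> \<bullet> x = 1}" by (rule facet_determines_hyperplane)
  then have "hyp \<alpha> 1 \<subseteq> hyp \<beta> 1" by (simp add: hyp_eq)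
  then show ?thesis using hyp_subset_imp_eq \<alpha> \<beta> by blast
qed

lemma ceilings_cell:
  assumes J: "root_ideal P S J"
  shows "ceilings \<Phi> (cell J) = (\<lambda>\<alpha>. hyp \<alpha> 1) ` maximal_roots J"
proof (intro equalityI subsetI)
  have JP: "J \<subseteq> P" using J by (simp add: root_ideal_def)
  fix H assume "H \<in> ceilings \<Phi> (cell J)"
  then have H: "H \<in> walls \<Phi> (cell J)" "0 \<notin> H" "same_side H 0 (cell J)" by (auto simp: ceilings_def)
  obtain \<alpha> where \<alpha>: "\<alpha> \<in> P" "H = hyp \<alpha> 1" using wall_root[OF H(1,2)] .
  obtain a r where a: "H = {y. a \<bullet> y = r}" "a \<bullet> 0 < r" "\<And>y. y \<in> cell J \<Longrightarrow> a \<bullet> y < r"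
    using H(3) by (auto simp: same_side_def)
  obtain y where y: "y \<in> cell J" using cell_nonempty J by blast
  have "\<alpha> \<in> J"
  proof (rule ccontr)
    assume "\<alpha> \<notin> J"
    then have y1: "y \<bullet> \<alpha> > 1" using y \<alpha> by (auto simp: wedge_def)
    \<comment> \<open>The form \<open>a\<close>, \<open>r\<close> describing the hyperplane is
      arbitrary, so \<open>y\<close> is scaled onto the hyperplane to compare it with \<alpha>.
      Since \<open>r > 0\<close>, the value of \<open>a\<close> at \<open>y\<close> would exceed
      \<open>r\<close>.\<close>
    then have "(1 / (y \<bullet> \<alpha>)) *\<^sub>R y \<in> H" using \<alpha> by (simp add: hyp_def)
    then have "a \<bullet> y = r * (y \<bullet> \<alpha>)" using a y1 by (auto simp: field_simps)
    then show False using a(2) a(3)[OF y] y1 by auto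
  qed
  moreover have "\<beta> = \<alpha>" if \<beta>: "\<beta> \<in> J" "root_le S \<alpha> \<beta>" for \<beta>
  proof (rule wall_root_unique[OF J _ \<alpha>(1)])
    fix x assume x: "x \<in> closure (cell J)" "x \<bullet> \<alpha> = 1"
    \<comment> \<open>On the facet \<beta> is squeezed between the value 1 of \<alpha> and its own
      upper bound 1.\<close>
    have "x \<bullet> \<alpha> \<le> x \<bullet> \<beta>"
      using root_le_inner_mono[OF \<beta>(2)] in_closure_wedge(1)[OF x(1)] simple_positive by blast
    then show "x \<bullet> \<beta> = 1" using in_closure_wedge(2)[OF x(1) \<beta>(1)] x(2) by simp
  qed (use H \<alpha> \<beta> JP in auto)
  ultimately show "H \<in> (\<lambda>\<alpha>. hyp \<alpha> 1) ` maximal_roots J"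
    using \<alpha> by (auto simp: maximal_roots_def)
next
  fix H assume "H \<in> (\<lambda>\<alpha>. hyp \<alpha> 1) ` maximal_roots J"
  then obtain \<alpha> where \<alpha>: "\<alpha> \<in> maximal_roots J" "H = hyp \<alpha> 1" by blast
  then have \<alpha>J: "\<alpha> \<in> J" by (simp add: maximal_roots_def)
  have "root_ideal P S (J - {\<alpha>})"
    using J \<alpha>(1) unfolding root_ideal_def maximal_roots_def by blast
  then have "H \<in> walls \<Phi> (cell J)" using hyp_in_walls(1)[OF J _ \<alpha>J] \<alpha> by simp
  moreover have "0 \<notin> H" using \<alpha> by (simp add: hyp_def)
  moreover have "same_side H 0 (cell J)"
    unfolding same_side_def
    using \<alpha>(2) \<alpha>J positive_root_nonzero J
    by (intro exI[of _ \<alpha>] exI[of _ 1]) (auto simp: hyp_eq wedge_def inner_commute root_ideal_def)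
  ultimately show "H \<in> ceilings \<Phi> (cell J)" by (simp add: ceilings_def)
qed

lemma floors_cell:
  assumes J: "root_ideal P S J"
  shows "floors \<Phi> (cell J) = (\<lambda>\<alpha>. hyp \<alpha> 1) ` minimal_roots (P - J)"
proof (intro equalityI subsetI)
  have JP: "J \<subseteq> P" using J by (simp add: root_ideal_def)
  fix H assume "H \<in> floors \<Phi> (cell J)"
  then have H: "H \<in> walls \<Phi> (cell J)" "0 \<notin> H" "separates H 0 (cell J)" by (auto simp: floors_def)
  obtain \<alpha> where \<alpha>: "\<alpha> \<in> P" "H = hyp \<alpha> 1" using wall_root[OF H(1,2)] .
  obtain a r where a: "H = {y. a \<bullet> y = r}" "a \<bullet> 0 < r" "\<And>y. y \<in> cell J \<Longrightarrow> a \<bullet> y > r"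
    using H(3) by (auto simp: separates_def)
  obtain y where y: "y \<in> cell J" using cell_nonempty J by blast
  have "\<alpha> \<notin> J"
  proof
    assume "\<alpha> \<in> J"
    then have y1: "y \<bullet> \<alpha> > 0" "y \<bullet> \<alpha> < 1" using y \<alpha> by (auto simp: wedge_def)
    then have "(1 / (y \<bullet> \<alpha>)) *\<^sub>R y \<in> H" using \<alpha> by (simp add: hyp_def)
    then have "a \<bullet> y = r * (y \<bullet> \<alpha>)" using a y1 by (auto simp: field_simps)
    then show False using a(2) a(3)[OF y] y1 by auto
  qed
  moreover have "\<beta> = \<alpha>" if \<beta>: "\<beta> \<in> P - J" "root_le S \<beta> \<alpha>" for \<beta>
  proof (rule wall_root_unique[OF J _ \<alpha>(1)])
    fix x assume x: "x \<in> closure (cell J)" "x \<bullet> \<alpha> = 1"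
    have "x \<bullet> \<beta> \<le> x \<bullet> \<alpha>"
      using root_le_inner_mono[OF \<beta>(2)] in_closure_wedge(1)[OF x(1)] simple_positive by blast
    then show "x \<bullet> \<beta> = 1" using in_closure_wedge(3)[OF x(1) \<beta>(1)] x(2) by simp
  qed (use H \<alpha> \<beta> in auto)
  ultimately show "H \<in> (\<lambda>\<alpha>. hyp \<alpha> 1) ` minimal_roots (P - J)"
    using \<alpha> by (auto simp: minimal_roots_def)
next
  fix H assume "H \<in> (\<lambda>\<alpha>. hyp \<alpha> 1) ` minimal_roots (P - J)"
  then obtain \<alpha> where \<alpha>: "\<alpha> \<in> minimal_roots (P - J)" "H = hyp \<alpha> 1" by blast
  then have \<alpha>J: "\<alpha> \<in> P" "\<alpha> \<notin> J" by (auto simp: minimal_roots_def)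
  have "root_ideal P S (insert \<alpha> J)"
    using J \<alpha>(1) unfolding root_ideal_def minimal_roots_def by blast
  then have "H \<in> walls \<Phi> (cell J)"
    \<comment> \<open>Minimality of \<alpha> outside \<open>J\<close> makes
      \<open>insert \<alpha> J\<close> an ideal, and the cell of \<open>J\<close> is its neighbour
      across the hyperplane on the far side from the origin.\<close>
    using hyp_in_walls(2)[of "insert \<alpha> J" \<alpha>] J \<alpha> \<alpha>J by simp
  moreover have "0 \<notin> H" using \<alpha> by (simp add: hyp_def)
  moreover have "separates H 0 (cell J)"
    unfolding separates_def
    using \<alpha>(2) \<alpha>J positive_root_nonzero
    by (intro exI[of _ \<alpha>] exI[of _ 1]) (auto simp: hyp_eq wedge_def inner_commute)
  ultimately show "H \<in> floors \<Phi> (cell J)" by (simp add: floors_def)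
qed

section \<open>The Panyushev complement and its maximal roots\<close>

lemma Pan_eq: "Pan P S J = {\<alpha> \<in> P. \<exists>\<gamma>\<in>minimal_roots (P - J). root_le S \<alpha> \<gamma>}"
  by (simp add: Pan_def minimal_roots_def)

lemma root_ideal_Pan: "root_ideal P S (Pan P S J)"
  unfolding root_ideal_def Pan_eq using root_le_trans by blast

text \<open>Minimal roots form an antichain: an element of the complement ideal above a minimal
  \<alpha> lies below some minimal \<gamma>, which forces \<alpha> = \<gamma> and equality
  throughout.\<close>

lemma maximal_roots_Pan: "maximal_roots (Pan P S J) = minimal_roots (P - J)"
proof (intro equalityI subsetI)
  fix \<alpha> assume \<alpha>: "\<alpha> \<in> maximal_roots (Pan P S J)"
  then obtain \<gamma> where \<gamma>: "\<gamma> \<in> minimal_roots (P - J)" "root_le S \<alpha> \<gamma>"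
    by (auto simp: maximal_roots_def Pan_eq)
  then have "\<gamma> \<in> Pan P S J" using root_le_refl by (auto simp: Pan_eq minimal_roots_def)
  then have "\<gamma> = \<alpha>" using \<alpha> \<gamma> by (auto simp: maximal_roots_def)
  then show "\<alpha> \<in> minimal_roots (P - J)" using \<gamma> by simp
next
  fix \<alpha> assume \<alpha>: "\<alpha> \<in> minimal_roots (P - J)"
  have "\<beta> = \<alpha>" if \<beta>: "\<beta> \<in> Pan P S J" "root_le S \<alpha> \<beta>" for \<beta>
  proof -
    obtain \<gamma> where \<gamma>: "\<gamma> \<in> minimal_roots (P - J)" "root_le S \<beta> \<gamma>"
      using \<beta>(1) by (auto simp: Pan_eq)
    have "root_le S \<alpha> \<gamma>" using root_le_trans \<beta>(2) \<gamma>(2) by blast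
    then have "\<alpha> = \<gamma>" using \<alpha> \<gamma>(1) by (auto simp: minimal_roots_def)
    then show ?thesis using root_le_antisym \<beta>(2) \<gamma>(2) by blast
  qed
  moreover have "\<alpha> \<in> Pan P S J" using \<alpha> root_le_refl by (auto simp: Pan_eq minimal_roots_def)
  ultimately show "\<alpha> \<in> maximal_roots (Pan P S J)" by (simp add: maximal_roots_def)
qed

lemma below_maximal_root:
  assumes "J \<subseteq> P" "\<alpha> \<in> J"
  shows "\<exists>\<gamma>\<in>maximal_roots J. root_le S \<alpha> \<gamma>"
proof -
  let ?U = "{\<beta> \<in> J. root_le S \<alpha> \<beta>}"
  have "finite J" using finite_subset[OF assms(1) positive_roots(2)] .
  then have U: "finite ?U" "?U \<noteq> {}" using assms(2) root_le_refl by auto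
  obtain \<gamma> where \<gamma>: "\<gamma> \<in> ?U" "\<And>\<beta>. \<beta> \<in> ?U \<Longrightarrow> v \<bullet> \<beta> \<le> v \<bullet> \<gamma>"
    using arg_min_if_finite[OF U, of "\<lambda>\<beta>. - (v \<bullet> \<beta>)"] that by (meson neg_less_iff_less not_le)
  have "\<beta> = \<gamma>" if \<beta>: "\<beta> \<in> J" "root_le S \<gamma> \<beta>" for \<beta>
  proof -
    have "\<beta> \<in> ?U" using \<beta> \<gamma>(1) root_le_trans by blast
    then show ?thesis using root_le_eqI[OF \<beta>(2)] \<gamma>(2) by blast
  qed
  then show ?thesis using \<gamma>(1) by (auto simp: maximal_roots_def)
qed

lemma ideal_generated_by_maximal:
  assumes "root_ideal P S J"
  shows "J = {\<alpha> \<in> P. \<exists>\<gamma>\<in>maximal_roots J. root_le S \<alpha> \<gamma>}"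
proof (intro equalityI subsetI)
  fix \<alpha> assume "\<alpha> \<in> J"
  then show "\<alpha> \<in> {\<alpha> \<in> P. \<exists>\<gamma>\<in>maximal_roots J. root_le S \<alpha> \<gamma>}"
    using assms below_maximal_root[of J] by (auto simp: root_ideal_def)
next
  fix \<alpha> assume "\<alpha> \<in> {\<alpha> \<in> P. \<exists>\<gamma>\<in>maximal_roots J. root_le S \<alpha> \<gamma>}"
  then show "\<alpha> \<in> J" using assms by (auto simp: root_ideal_def maximal_roots_def)
qed

text \<open>Distinct positive roots give distinct hyperplanes at level 1, so equal sets of
  hyperplanes give equal sets of roots, and these generate the ideals.\<close>

lemma ideal_eq_Pan_if_ceilings_eq_floors:
  assumes J: "root_ideal P S J" and I: "root_ideal P S I"
    and eq: "ceilings \<Phi> (cell J) = floors \<Phi> (cell I)"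
  shows "J = Pan P S I"
proof -
  have "maximal_roots J \<subseteq> P" "minimal_roots (P - I) \<subseteq> P"
    using J by (auto simp: root_ideal_def maximal_roots_def minimal_roots_def)
  then have "maximal_roots J = minimal_roots (P - I)"
    using eq unfolding ceilings_cell[OF J] floors_cell[OF I]
    by (simp add: inj_on_image_eq_iff[OF hyp_inj])
  then show ?thesis using ideal_generated_by_maximal[OF J] by (simp add: Pan_eq)
qed

end

theorem theorem17:
  fixes \<Phi> P S I :: "'a::euclidean_space set"
  assumes "crystallographic_root_system \<Phi>"
    and "positive_system \<Phi> P"
    and "simple_system P S"
    and "root_ideal P S I"
  shows "theta_inv \<Phi> P (Pan P S I) \<in> dominant_regions \<Phi> P
    \<and> ceilings \<Phi> (theta_inv \<Phi> P (Pan P S I)) = floors \<Phi> (theta_inv \<Phi> P I)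
    \<and> (\<forall>R\<in>dominant_regions \<Phi> P.
          ceilings \<Phi> R = floors \<Phi> (theta_inv \<Phi> P I) \<longrightarrow> R = theta_inv \<Phi> P (Pan P S I))"
proof -
  obtain v where "\<forall>\<alpha>\<in>\<Phi>. v \<bullet> \<alpha> \<noteq> 0" "P = {\<alpha>\<in>\<Phi>. v \<bullet> \<alpha> > 0}"
    using assms(2) by (auto simp: positive_system_def)
  then interpret positive_roots \<Phi> P S v
    using assms by unfold_locales auto
  note I = assms(4) and Pan = root_ideal_Pan[of I]
  have "cell (Pan P S I) \<in> dominant_regions \<Phi> P"
    using cell_in_dominant_regions cell_nonempty[OF Pan] Pan by (simp add: root_ideal_def)
  moreover have "ceilings \<Phi> (cell (Pan P S I)) = floors \<Phi> (cell I)"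
    by (simp add: ceilings_cell[OF Pan] floors_cell[OF I] maximal_roots_Pan)
  moreover have "R = cell (Pan P S I)"
    if "R \<in> dominant_regions \<Phi> P" "ceilings \<Phi> R = floors \<Phi> (cell I)" for R
    using ideal_eq_Pan_if_ceilings_eq_floors[OF _ I] dominant_region_eq_cell[OF that(1)] that(2) by metis
  ultimately show ?thesis
    unfolding theta_inv_eq_cell[OF I] theta_inv_eq_cell[OF Pan] by blast
qed

end
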